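(* Let $q$ be a prime power, $n$ a positive integer, and let $f\in\mathcal{L}_{n,q}$ be a $q$-polynomial over $\mathbb{F}_{q^n}$. If $f$ is a low weight polynomial, then $(\mathbb{S}_f,+,\cdot)$ is a field, where $+$ and $\cdot$ are the usual sum and product of matrices.
   Context: $\mathcal{L}_{n,q}$ is the set of $q$-polynomials (linearized polynomials) $\sum_{i=0}^{n-1}a_ix^{q^i}$ with $a_i\in\mathbb{F}_{q^n}$, identified with the $\mathbb{F}_q$-linear endomorphisms of $\mathbb{F}_{q^n}$. The graph of $f$ is $\mathcal{G}_f=\{(y,f(y)) : y\in\mathbb{F}_{q^n}\}\subseteq \mathrm{AG}(2,q^n)=\mathbb{F}_{q^n}^2$. The polynomial $f$ is a low weight polynomial if $|\ell\cap\mathcal{G}_f|<q^{n/2}$ for every affine line $\ell$ of $\mathrm{AG}(2,q^n)$. The set $\mathbb{S}_f=\{A\in\mathbb{F}_{q^n}^{2\times 2} : A\mathcal{G}_f\subseteq\mathcal{G}_f\}$, where $A\mathcal{G}_f=\left\{A\begin{pmatrix}y\\ f(y)\end{pmatrix} : y\in\mathbb{F}_{q^n}\right\}$ (row and column vectors being identified). *)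

theory Defs
  imports
    "HOL-Analysis.Analysis"
    "HOL-Algebra.Ring"
    "HOL-Computational_Algebra.Polynomial"
    "HOL-Number_Theory.Prime_Powers"
begin

definition q_polynomials :: "nat \<Rightarrow> nat \<Rightarrow> 'a::field poly set" where
  "q_polynomials n q = {\<Sum>i<n. monom (a i) (q ^ i) | a. True}"

definition poly_graph :: "'a::field poly \<Rightarrow> ('a ^ 2) set" where
  "poly_graph f = {vector [y, poly f y] | y. True}"

definition affine_lines :: "('a::field ^ 2) set set" where
  "affine_lines = {{p + t *s d | t. True} | p d. d \<noteq> 0}"

definition low_weight :: "nat \<Rightarrow> nat \<Rightarrow> 'a::field poly \<Rightarrow> bool" where
  "low_weight n q f \<longleftrightarrow>
     (\<forall>l \<in> affine_lines. real (card (l \<inter> poly_graph f)) < real q powr (real n / 2))"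

definition graph_stabilizer :: "'a::field poly \<Rightarrow> ('a ^ 2 ^ 2) set" where
  "graph_stabilizer f = {A. (\<lambda>v. A *v v) ` poly_graph f \<subseteq> poly_graph f}"

text \<open>The product on \<^typ>\<open>'a ^ 2 ^ 2\<close> has to be \<open>(**)\<close>: the type-class operation
  \<open>(*)\<close> is componentwise there.\<close>

definition matrix_ring_on :: "('a::field ^ 2 ^ 2) set \<Rightarrow> ('a ^ 2 ^ 2) ring" where
  "matrix_ring_on S =
     \<lparr>carrier = S, monoid.mult = (**), one = mat 1, zero = 0, add = (+)\<rparr>"

end

theory Submission
  imports Defs "HOL-Number_Theory.Residues"
begin

text \<open>Since \<open>f\<close> is additive, its graph \<open>G\<close> is an additive group of order \<open>q ^ n\<close>. A nonzero
  singular \<open>A\<close> stabilizing \<open>G\<close> would have its kernel and its image in two lines, so both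
  \<open>ker A \<inter> G\<close> and \<open>A G\<close> would have fewer than \<open>q powr (n / 2)\<close> elements, contradicting
  \<open>card G \<le> card (ker A \<inter> G) * card (A G)\<close>. Hence every nonzero \<open>A\<close> in the stabilizer is
  invertible, and \<open>A G = G\<close> puts its inverse in the stabilizer, which is thus a finite division
  ring.

  For commutativity, the special case of Wedderburn's theorem for a division ring \<open>D\<close> of
  \<open>2 \<times> 2\<close> matrices over a finite field suffices. If \<open>D\<close> is not commutative and \<open>z\<close> is the number
  of scalar matrices in it, then the trace and the determinant of every nonscalar \<open>A\<close> in \<open>D\<close> are
  again scalars of \<open>D\<close>, because \<open>[A\<^sup>2, Y] = trace A \<cdot> [A, Y]\<close>. Nonscalars with the same trace and
  determinant are conjugate in \<open>D\<close>, and the centralizer of \<open>A\<close> contains the \<open>z\<^sup>2 - 1\<close> nonzero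
  combinations \<open>s + r A\<close>. Comparing \<open>card D\<close> with the total size of the at most \<open>z (z - 1)\<close>
  classes gives \<open>card D \<le> z\<^sup>2\<close>, while \<open>D\<close> properly contains the \<open>z\<^sup>2\<close> combinations of \<open>1\<close>
  and \<open>A\<close>.\<close>

section \<open>Two-by-two matrices\<close>

lemma mat2_eq_iff:
  fixes A B :: "'a::field^2^2"
  shows "A = B \<longleftrightarrow> A$1$1 = B$1$1 \<and> A$1$2 = B$1$2 \<and> A$2$1 = B$2$1 \<and> A$2$2 = B$2$2"
  by (auto simp: vec_eq_iff forall_2)

lemmas mat2_entries = mat2_eq_iff matrix_matrix_mult_def sum_2 mat_def trace_def det_2

text \<open>The off-diagonal entries and the diagonal difference of a matrix commuting with
  \<open>A\<close> are a common multiple of those of \<open>A\<close>. So the centralizer of a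
  nonscalar \<open>A\<close> is spanned by \<open>mat 1\<close> and \<open>A\<close>, hence
  commutative.\<close>

lemma commute_nonscalar_trans:
  fixes A B C :: "'a::field^2^2"
  assumes "A \<notin> range mat" "A ** B = B ** A" "A ** C = C ** A"
  shows "B ** C = C ** B"
proof -
  have ns: "A$1$2 \<noteq> 0 \<or> A$2$1 \<noteq> 0 \<or> A$2$2 - A$1$1 \<noteq> 0"
    using assms(1) by (auto simp: image_iff mat2_entries)
  have *: "A$1$2 * M$2$1 = M$1$2 * A$2$1 \<and> A$1$2 * (M$2$2 - M$1$1) = M$1$2 * (A$2$2 - A$1$1)
      \<and> A$2$1 * (M$2$2 - M$1$1) = M$2$1 * (A$2$2 - A$1$1)"
    if "A ** M = M ** A" for M
  proof -
    have e: "A$1$1 * M$1$1 + A$1$2 * M$2$1 = M$1$1 * A$1$1 + M$1$2 * A$2$1"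
      "A$1$1 * M$1$2 + A$1$2 * M$2$2 = M$1$1 * A$1$2 + M$1$2 * A$2$2"
      "A$2$1 * M$1$1 + A$2$2 * M$2$1 = M$2$1 * A$1$1 + M$2$2 * A$2$1"
      using that by (simp_all only: mat2_eq_iff matrix_matrix_mult_def sum_2 vec_lambda_beta)
    have h1: "a * (m - n) = k * (b - c)" if "c * k + a * m = n * a + k * b" for a b c k m n :: 'a
    proof -
      have "a * (m - n) = c * k + a * m - (n * a + k * b) + k * (b - c)"
        by (simp add: algebra_simps)
      then show ?thesis using that by simp
    qed
    have h2: "a * (m - n) = k * (b - c)" if "a * n + b * k = k * c + m * a" for a b c k m n :: 'a
    proof -
      have "a * (m - n) = k * c + m * a - (a * n + b * k) + k * (b - c)"
        by (simp add: algebra_simps)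
      then show ?thesis using that by simp
    qed
    have "A$1$2 * M$2$1 = M$1$2 * A$2$1"
      using e(1) by (simp only: mult.commute[of "A$1$1" "M$1$1"] add_left_cancel)
    with h1[OF e(2)] h2[OF e(3)] show ?thesis by blast
  qed
  have multiple: "\<exists>k. M$1$2 = k * A$1$2 \<and> M$2$1 = k * A$2$1 \<and> M$2$2 - M$1$1 = k * (A$2$2 - A$1$1)"
    if M: "A ** M = M ** A" for M
  proof -
    consider "A$1$2 \<noteq> 0" | "A$2$1 \<noteq> 0" | "A$2$2 - A$1$1 \<noteq> 0" using ns by blast
    then show ?thesis
    proof cases
      case 1 then show ?thesis
        using *[OF M] by (intro exI[of _ "M$1$2 / A$1$2"]) (simp add: field_simps)
    next
      case 2 then show ?thesis
        using *[OF M] by (intro exI[of _ "M$2$1 / A$2$1"]) (simp add: field_simps)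
    next
      case 3 then show ?thesis
        using *[OF M] by (intro exI[of _ "(M$2$2 - M$1$1) / (A$2$2 - A$1$1)"])
          (simp add: nonzero_eq_divide_eq nonzero_divide_eq_eq mult.commute)
    qed
  qed
  have "\<exists>s k. M = mat s + mat k ** A" if M: "A ** M = M ** A" for M
  proof -
    obtain k where "M$1$2 = k * A$1$2" "M$2$1 = k * A$2$1" "M$2$2 - M$1$1 = k * (A$2$2 - A$1$1)"
      using multiple[OF M] by blast
    then have "M = mat (M$1$1 - k * A$1$1) + mat k ** A"
      by (simp add: mat2_entries algebra_simps)
    then show ?thesis by blast
  qed
  from this[OF assms(2)] this[OF assms(3)] obtain s k r l where
    "B = mat s + mat k ** A" "C = mat r + mat l ** A"
    by blast
  then show ?thesis by (simp add: mat2_entries algebra_simps)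
qed

lemma cayley_hamilton_2:
  fixes A :: "'a::field^2^2"
  shows "mat (det A) = mat (trace A) ** A - A ** A"
  by (simp add: mat2_entries algebra_simps)

text \<open>By Cayley-Hamilton, \<open>A ** A\<close> is \<open>trace A\<close> times
  \<open>A\<close> minus a scalar, and that scalar drops out of the commutator with
  \<open>Y\<close>.\<close>

lemma commutator_square_2:
  fixes A Y :: "'a::field^2^2"
  shows "(A ** A) ** Y - Y ** (A ** A) = mat (trace A) ** (A ** Y - Y ** A)"
  by (simp add: mat2_entries algebra_simps)

lemma mat_mult_commute:
  fixes A :: "'a::field^2^2"
  shows "mat s ** A = A ** mat s"
  by (simp add: mat2_entries)

text \<open>The factor \<open>mat (trace B) - B\<close> is the adjugate of \<open>B\<close>. In
  \<open>A ** X - X ** B\<close> the terms with \<open>Y\<close> between \<open>A\<close> and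
  \<open>B\<close> cancel, and Cayley-Hamilton reduces the rest to \<open>Y\<close> times the common
  determinant on either side.\<close>

lemma intertwiner_2:
  fixes A B Y :: "'a::field^2^2"
  assumes "trace A = trace B" "det A = det B"
  defines "X \<equiv> A ** Y - Y ** (mat (trace B) - B)"
  shows "A ** X = X ** B"
proof -
  have "A ** X - X ** B = Y ** (mat (trace B) ** B - B ** B) - (mat (trace B) ** A - A ** A) ** Y"
    unfolding X_def by (simp add: mat2_eq_iff matrix_matrix_mult_def sum_2 mat_def algebra_simps)
  also have "\<dots> = Y ** mat (det B) - mat (det B) ** Y"
    using cayley_hamilton_2[of A] cayley_hamilton_2[of B] assms by metis
  finally show ?thesis by (simp add: mat_mult_commute)
qed

lemma mat_add_mult_eq_0_iff:
  fixes A :: "'a::field^2^2"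
  assumes "A \<notin> range mat"
  shows "mat s + mat r ** A = 0 \<longleftrightarrow> s = 0 \<and> r = 0"
proof
  assume *: "mat s + mat r ** A = 0"
  have "r = 0"
  proof (rule ccontr)
    assume "r \<noteq> 0"
    then have "A = mat (- s / r)" using *
      by (auto simp: mat2_entries field_simps eq_neg_iff_add_eq_0)
    then show False using assms by blast
  qed
  then show "s = 0 \<and> r = 0" using * by (simp add: mat2_entries)
qed (simp add: mat2_entries)

lemma matrix_add_rdistrib_2:
  fixes A B C :: "'a::field^2^2"
  shows "(A + B) ** C = A ** C + B ** C"
  by (simp add: mat2_entries algebra_simps)

section \<open>Finite division rings of two-by-two matrices\<close>

locale matrix_division_ring =
  fixes D :: "('a::{field,finite}^2^2) set"
  assumes one_closed: "mat 1 \<in> D"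
    and diff_closed: "\<And>A B. A \<in> D \<Longrightarrow> B \<in> D \<Longrightarrow> A - B \<in> D"
    and mult_closed: "\<And>A B. A \<in> D \<Longrightarrow> B \<in> D \<Longrightarrow> A ** B \<in> D"
    and inverse_exists: "\<And>A. A \<in> D \<Longrightarrow> A \<noteq> 0 \<Longrightarrow> \<exists>B\<in>D. A ** B = mat 1"
begin

lemma zero_closed: "0 \<in> D"
  using diff_closed[OF one_closed one_closed] by simp

lemma add_closed: "A \<in> D \<Longrightarrow> B \<in> D \<Longrightarrow> A + B \<in> D"
  using diff_closed[of A "0 - B"] diff_closed[OF zero_closed, of B] by simp

lemma mult_right_cancel:
  assumes "C \<in> D" "C \<noteq> 0" "A ** C = B ** C"
  shows "A = B"
proof -
  obtain C' where C': "C ** C' = mat 1" using inverse_exists assms by blast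
  have "A ** (C ** C') = B ** (C ** C')" using assms(3) by (simp add: matrix_mul_assoc)
  then show ?thesis using C' by simp
qed

lemma mult_left_cancel:
  assumes "C \<in> D" "C \<noteq> 0" "C ** A = C ** B"
  shows "A = B"
proof -
  obtain C' where "C ** C' = mat 1" using inverse_exists assms by blast
  then have C': "C' ** C = mat 1" using matrix_left_right_inverse by blast
  have "(C' ** C) ** A = (C' ** C) ** B" using assms(3) by (simp flip: matrix_mul_assoc)
  then show ?thesis using C' by simp
qed

lemma mult_nonzero:
  assumes "A \<in> D" "B \<in> D" "A \<noteq> 0" "B \<noteq> 0"
  shows "A ** B \<noteq> 0"
proof
  assume "A ** B = 0"
  then have "A ** B = 0 ** B" by simp
  then show False using mult_right_cancel assms by blast
qed

section \<open>Scalars of the division ring and classes of equal trace and determinant\<close>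

definition scalars :: "'a set" where
  "scalars = {s. mat s \<in> D}"

text \<open>Nonscalars with characteristic polynomial \<open>x^2 - t x + d\<close>; they stand in
  for conjugacy classes when \<open>D\<close> is not commutative.\<close>

definition char_class :: "'a \<Rightarrow> 'a \<Rightarrow> ('a^2^2) set" where
  "char_class t d = {A \<in> D - range mat. trace A = t \<and> det A = d}"

lemma zero_in_scalars: "0 \<in> scalars"
  using zero_closed by (simp add: scalars_def mat_0)

lemma one_in_scalars: "1 \<in> scalars"
  using one_closed by (simp add: scalars_def)

lemma scalar_combination_closed:
  "s \<in> scalars \<Longrightarrow> r \<in> scalars \<Longrightarrow> A \<in> D \<Longrightarrow> mat s + mat r ** A \<in> D"
  by (simp add: scalars_def add_closed mult_closed)

lemma trace_det_in_scalars:
  assumes "A \<in> D" "Y \<in> D" "A ** Y \<noteq> Y ** A"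
  shows "trace A \<in> scalars" "det A \<in> scalars"
proof -
  let ?M = "A ** Y - Y ** A"
  have "?M \<in> D" "?M \<noteq> 0" using assms by (simp_all add: diff_closed mult_closed)
  then obtain W where W: "W \<in> D" "?M ** W = mat 1" using inverse_exists by blast
  \<comment> \<open>Cancelling the commutator by its inverse \<open>W\<close> isolates
    \<open>mat (trace A)\<close> as an expression in elements of \<open>D\<close>.\<close>
  have "(A ** A ** Y - Y ** (A ** A)) ** W = mat (trace A) ** (?M ** W)"
    unfolding commutator_square_2 by (rule matrix_mul_assoc[symmetric])
  then have "mat (trace A) = (A ** A ** Y - Y ** (A ** A)) ** W" using W by simp
  also have "\<dots> \<in> D" using assms W by (intro diff_closed mult_closed)
  finally show t: "trace A \<in> scalars" by (simp add: scalars_def)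
  then show "det A \<in> scalars" using assms
    by (simp add: scalars_def cayley_hamilton_2 diff_closed mult_closed)
qed

lemma conjugate_exists:
  assumes "A \<in> char_class t d" "B \<in> char_class t d" "t \<in> scalars"
    and Y: "Y \<in> D" "A ** Y \<noteq> Y ** A"
  shows "\<exists>X\<in>D. X \<noteq> 0 \<and> A ** X = X ** B"
proof -
  \<comment> \<open>For \<open>W = mat 1\<close> the intertwiner is \<open>A + B - mat t\<close>,
    which vanishes only if \<open>mat t - B = A\<close>. In that case \<open>W = Y\<close> turns it
    into the nonzero commutator of \<open>A\<close> and \<open>Y\<close>.\<close>
  define W where "W = (if mat t - B = A then Y else mat 1)"
  define X where "X = A ** W - W ** (mat (trace B) - B)"
  have AB: "A \<in> D" "B \<in> D" "trace B = t" "trace A = trace B" "det A = det B"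
    using assms by (auto simp: char_class_def)
  have "A ** X = X ** B" unfolding X_def using AB by (intro intertwiner_2)
  moreover have "X \<in> D" unfolding X_def W_def using AB assms one_closed
    by (auto simp: scalars_def intro!: diff_closed mult_closed)
  moreover have "X \<noteq> 0" unfolding X_def W_def using AB Y by auto
  ultimately show ?thesis by blast
qed

text \<open>An injective form of orbit counting. Fix \<open>A\<close> and, for each
  \<open>B\<close>, a nonzero \<open>x B\<close> with \<open>A ** x B = x B ** B\<close>.
  Multiplying \<open>x B\<close> on the left by a nonzero combination of \<open>mat 1\<close> and
  \<open>A\<close> keeps this relation, so the product determines \<open>B\<close> by left
  cancellation, and then the combination by right cancellation.\<close>

lemma card_char_class_le:
  assumes t: "t \<in> scalars"
    and nc: "\<And>A. A \<in> D - range mat \<Longrightarrow> \<exists>Y\<in>D. A ** Y \<noteq> Y ** A"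
  shows "card (char_class t d) * (card scalars ^ 2 - 1) \<le> card D - 1"
proof (cases "char_class t d = {}")
  case False
  then obtain A where A: "A \<in> char_class t d" by blast
  then have AD: "A \<in> D" "A \<notin> range mat" by (auto simp: char_class_def)
  obtain Y where Y: "Y \<in> D" "A ** Y \<noteq> Y ** A" using nc[of A] AD by blast
  have "\<forall>B\<in>char_class t d. \<exists>X. X \<in> D \<and> X \<noteq> 0 \<and> A ** X = X ** B"
    using conjugate_exists[OF A _ t Y] by blast
  then obtain x where x: "\<And>B. B \<in> char_class t d \<Longrightarrow> x B \<in> D \<and> x B \<noteq> 0 \<and> A ** x B = x B ** B"
    by metis
  define comb where "comb = (\<lambda>(s, r). mat s + mat r ** A)"
  define P where "P = scalars \<times> scalars - {(0, 0)}"
  define h where "h = (\<lambda>(B, p). comb p ** x B)"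
  have comb: "comb p \<in> D \<and> comb p \<noteq> 0" if "p \<in> P" for p
    using that AD mat_add_mult_eq_0_iff[of A] scalar_combination_closed
    by (auto simp: comb_def P_def)
  have comb_inj: "p = p'" if "comb p = comb p'" for p p'
  proof -
    have "mat (fst p - fst p') + mat (snd p - snd p') ** A = comb p - comb p'"
      by (simp add: comb_def case_prod_beta mat2_entries algebra_simps)
    then show ?thesis using that mat_add_mult_eq_0_iff[of A] AD by (simp add: prod_eq_iff)
  qed
  have comb_commute: "A ** comb p = comb p ** A" for p
    by (simp add: comb_def case_prod_beta mat2_entries algebra_simps)
  have h_mem: "h (B, p) \<in> D \<and> h (B, p) \<noteq> 0" if "B \<in> char_class t d" "p \<in> P" for B p
    using x[OF that(1)] comb[OF that(2)] by (simp add: h_def mult_closed mult_nonzero)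
  have h_intertwines: "A ** h (B, p) = h (B, p) ** B" if "B \<in> char_class t d" for B p
    using x[OF that] comb_commute[of p] unfolding h_def
    by (metis (no_types, lifting) case_prod_conv matrix_mul_assoc)
  have "inj_on h (char_class t d \<times> P)"
  proof (rule inj_onI, clarify)
    fix B p B' p'
    assume B: "B \<in> char_class t d" "B' \<in> char_class t d" and p: "p \<in> P" "p' \<in> P"
      and eq: "h (B, p) = h (B', p')"
    have "h (B, p) ** B = h (B, p) ** B'"
      using h_intertwines B eq by metis
    then have "B = B'" using mult_left_cancel h_mem[OF B(1) p(1)] by blast
    moreover then have "comb p = comb p'"
      using eq mult_right_cancel x[OF B(1)] unfolding h_def by auto
    ultimately show "B = B' \<and> p = p'" using comb_inj by blast
  qed
  moreover have "h ` (char_class t d \<times> P) \<subseteq> D - {0}"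
    using h_mem by auto
  ultimately have "card (char_class t d \<times> P) \<le> card (D - {0})"
    by (intro card_inj_on_le) auto
  moreover have "card P = card scalars ^ 2 - 1"
    using zero_in_scalars by (simp add: P_def card_Diff_singleton power2_eq_square)
  ultimately show ?thesis using zero_closed
    by (simp add: card_cartesian_product card_Diff_singleton)
qed simp

section \<open>Commutativity by counting\<close>

theorem mult_commute:
  assumes "A \<in> D" "B \<in> D"
  shows "A ** B = B ** A"
proof (rule ccontr)
  assume AB: "A ** B \<noteq> B ** A"
  \<comment> \<open>A nonscalar \<open>C\<close> commuting with all of \<open>D\<close> would force
    \<open>A\<close> and \<open>B\<close> to commute.\<close>
  have nc: "\<exists>Y\<in>D. C ** Y \<noteq> Y ** C" if "C \<in> D - range mat" for C
    using that AB assms commute_nonscalar_trans[of C A B] by blast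
  have A: "A \<notin> range mat" using AB mat_mult_commute by blast
  define z where "z = card scalars"
  define N where "N = card D - 1"
  have "card {0, 1::'a} \<le> z" unfolding z_def
    using zero_in_scalars one_in_scalars by (intro card_mono) auto
  then have z: "z \<ge> 2" by simp

  have "card (scalars \<times> scalars) < card D"
  proof -
    let ?comb = "\<lambda>(s, r). mat s + mat r ** A"
    have "inj_on ?comb (scalars \<times> scalars)"
    proof (rule inj_onI, clarify)
      fix s r s' r' :: 'a assume "mat s + mat r ** A = mat s' + mat r' ** A"
      then have "mat (s - s') + mat (r - r') ** A = 0"
        by (simp add: mat2_entries algebra_simps)
      then show "s = s' \<and> r = r'" using mat_add_mult_eq_0_iff[OF A] by simp
    qed
    moreover have "?comb ` (scalars \<times> scalars) \<subset> D"
    proof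
      show "?comb ` (scalars \<times> scalars) \<subseteq> D"
        using scalar_combination_closed assms by auto
      have "B \<notin> ?comb ` (scalars \<times> scalars)"
      proof
        assume "B \<in> ?comb ` (scalars \<times> scalars)"
        then obtain s r where "B = mat s + mat r ** A" by auto
        then have "A ** B = B ** A" by (simp add: mat2_entries algebra_simps)
        then show False using AB by blast
      qed
      then show "?comb ` (scalars \<times> scalars) \<noteq> D" using assms by blast
    qed
    ultimately show ?thesis by (metis card_image finite psubset_card_mono)
  qed
  then have N: "N \<ge> z * z" by (simp add: N_def z_def card_cartesian_product)

  \<comment> \<open>Nonzero elements are invertible, so only nonzero determinants occur:
    \<open>I\<close> has \<open>z * (z - 1)\<close> pairs.\<close>
  define I where "I = scalars \<times> (scalars - {0})"
  have cover: "D \<subseteq> mat ` scalars \<union> (\<Union>p\<in>I. char_class (fst p) (snd p))"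
  proof
    fix C assume C: "C \<in> D"
    show "C \<in> mat ` scalars \<union> (\<Union>p\<in>I. char_class (fst p) (snd p))"
    proof (cases "C \<in> range mat")
      case True then show ?thesis using C by (auto simp: scalars_def)
    next
      case False
      then obtain Y where "Y \<in> D" "C ** Y \<noteq> Y ** C" using nc C by blast
      then have "trace C \<in> scalars" "det C \<in> scalars" using trace_det_in_scalars C by blast+
      moreover have "det C \<noteq> 0"
      proof -
        have "C \<noteq> 0" using False by (metis mat_0 rangeI)
        then have "\<exists>W. C ** W = mat 1" using inverse_exists C by blast
        then have "invertible C" using matrix_left_right_inverse by (auto simp: invertible_def)
        then show ?thesis by (simp add: invertible_det_nz)
      qed
      ultimately show ?thesis using C False by (force simp: char_class_def I_def)
    qed
  qed
  have "card D > 0" using zero_closed by (auto simp: card_gt_0_iff)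
  then have "N + 1 = card D" by (simp add: N_def)
  also have "\<dots> \<le> card (mat ` scalars :: ('a^2^2) set) +
      card (\<Union>p\<in>I. char_class (fst p) (snd p))"
    using card_mono[OF _ cover] card_Un_le order_trans by fastforce
  also have "\<dots> \<le> z + (\<Sum>p\<in>I. card (char_class (fst p) (snd p)))"
    unfolding z_def using card_UN_le[of I "\<lambda>p. char_class (fst p) (snd p)"]
    by (intro add_mono card_image_le) auto
  \<comment> \<open>The factor \<open>z^2 - 1\<close> lets the class bound be applied summand by
    summand without division.\<close>
  finally have "(N + 1) * (z\<^sup>2 - 1) \<le>
      (z + (\<Sum>p\<in>I. card (char_class (fst p) (snd p)))) * (z\<^sup>2 - 1)"
    by (rule mult_right_mono) simp
  also have "\<dots> = z * (z\<^sup>2 - 1) +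
      (\<Sum>p\<in>I. card (char_class (fst p) (snd p)) * (z\<^sup>2 - 1))"
    by (simp only: add_mult_distrib sum_distrib_right)
  also have "\<dots> \<le> z * (z\<^sup>2 - 1) + (\<Sum>p\<in>I. N)"
    using card_char_class_le[OF _ nc] by (intro add_left_mono sum_mono) (auto simp: z_def N_def I_def)
  also have "\<dots> = z * (z\<^sup>2 - 1) + z * (z - 1) * N"
    using zero_in_scalars by (simp add: I_def card_cartesian_product card_Diff_singleton z_def)
  finally have le: "(N + 1) * (z\<^sup>2 - 1) \<le> z * (z\<^sup>2 - 1) + z * (z - 1) * N" .
  \<comment> \<open>Writing \<open>z = w + 1\<close> removes the natural subtractions. Cancelling
    the positive factor \<open>w\<close> leaves \<open>N \<le> w * (w + 2) = z^2 - 1\<close>,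
    against \<open>N \<ge> z * z\<close>.\<close>
  obtain w where w: "z = w + 1" "w \<ge> 1" using z that[of "z - 1"] by simp
  have "z\<^sup>2 - 1 = w * (w + 2)" using w by (simp add: power2_eq_square algebra_simps)
  from le[unfolded this] have "w * ((N + 1) * (w + 2)) \<le> w * ((w + 1) * (w + 2) + (w + 1) * N)"
    unfolding w(1) by (simp add: algebra_simps)
  then have "(N + 1) * (w + 2) \<le> (w + 1) * (w + 2) + (w + 1) * N" using w by simp
  then have "N \<le> w * (w + 2)" by (simp add: algebra_simps)
  then show False using N w by (simp add: algebra_simps)
qed

end

section \<open>Stabilizers of graphs of linearized polynomials\<close>

text \<open>The characteristic divides the field order, a power of \<open>p\<close>, so it equals
  \<open>p\<close>, and every exponent \<open>q ^ i\<close> gives a power of the Frobenius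
  map.\<close>

lemma q_polynomial_add:
  fixes f :: "'a::{field,finite} poly"
  assumes "primepow q" "CARD('a) = q ^ n" "f \<in> q_polynomials n q"
  shows "poly f (x + y) = poly f x + poly f y"
proof -
  obtain p k where p: "prime p" "q = p ^ k" using assms(1) by (auto simp: primepow_def)
  have CHAR: "prime CHAR('a)" by (simp add: prime_CHAR_semidom finite_imp_CHAR_pos)
  have "CHAR('a) dvd p ^ (k * n)"
    using CHAR_dvd_CARD[where 'a = 'a] assms(2) p by (simp add: power_mult)
  then have "CHAR('a) = p" using CHAR p prime_dvd_power primes_dvd_imp_eq by blast
  then have "(x + y) ^ (q ^ i) = x ^ (q ^ i) + y ^ (q ^ i)" for i
    using CHAR p by (intro freshmans_dream'[of _ "k * i"]) (simp_all add: power_mult)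
  then show ?thesis using assms(3)
    by (auto simp: q_polynomials_def poly_sum poly_monom algebra_simps sum.distrib)
qed

lemma mem_poly_graph_iff: "v \<in> poly_graph f \<longleftrightarrow> v $ 2 = poly f (v $ 1)"
proof
  assume "v $ 2 = poly f (v $ 1)"
  then have "v = vector [v $ 1, poly f (v $ 1)]" by (simp add: vec_eq_iff forall_2)
  then show "v \<in> poly_graph f" unfolding poly_graph_def by blast
qed (auto simp: poly_graph_def)

lemma mem_graph_stabilizer_iff:
  "A \<in> graph_stabilizer f \<longleftrightarrow> (\<forall>v\<in>poly_graph f. A *v v \<in> poly_graph f)"
  by (auto simp: graph_stabilizer_def)

lemma card_poly_graph: "card (poly_graph (f :: 'a::{field,finite} poly)) = CARD('a)"
proof -
  have "poly_graph f = range (\<lambda>y. vector [y, poly f y])" by (auto simp: poly_graph_def)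
  moreover have "inj (\<lambda>y. vector [y, poly f y] :: 'a^2)"
    by (rule injI) (metis vector_2(1))
  ultimately show ?thesis by (simp add: card_image)
qed

text \<open>With \<open>g\<close> choosing one preimage in \<open>G\<close> per image point,
  \<open>v\<close> is recovered from \<open>v - g (A *v v)\<close>, which lies in the kernel, and
  \<open>A *v v\<close>.\<close>

lemma card_le_kernel_times_image:
  fixes A :: "'a::{field,finite}^2^2"
  assumes "\<And>v w. v \<in> G \<Longrightarrow> w \<in> G \<Longrightarrow> v - w \<in> G"
  shows "card G \<le> card {v \<in> G. A *v v = 0} * card ((\<lambda>v. A *v v) ` G)"
proof -
  define g where "g = inv_into G (\<lambda>v. A *v v)"
  have g: "g (A *v v) \<in> G \<and> A *v g (A *v v) = A *v v" if "v \<in> G" for v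
    using that unfolding g_def by (simp add: inv_into_into f_inv_into_f)
  have "inj_on (\<lambda>v. (v - g (A *v v), A *v v)) G"
    by (auto intro!: inj_onI)
  moreover have "(\<lambda>v. (v - g (A *v v), A *v v)) ` G \<subseteq> {v \<in> G. A *v v = 0} \<times> (\<lambda>v. A *v v) ` G"
    using g assms by (auto simp: matrix_vector_mult_diff_distrib)
  ultimately have "card G \<le> card ({v \<in> G. A *v v = 0} \<times> (\<lambda>v. A *v v) ` G)"
    by (intro card_inj_on_le) auto
  then show ?thesis by (simp add: card_cartesian_product)
qed

section \<open>Lines containing kernels and singular images\<close>

lemma linear_equation_subset_line:
  fixes a b :: "'a::field"
  assumes "a \<noteq> 0 \<or> b \<noteq> 0"
  shows "\<exists>l\<in>affine_lines. {v :: 'a^2. a * v $ 1 + b * v $ 2 = 0} \<subseteq> l"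
proof
  define d :: "'a^2" where "d = vector [- b, a]"
  have "d \<noteq> 0" using assms by (auto simp: d_def vec_eq_iff forall_2)
  then show "{0 + t *s d | t. True} \<in> affine_lines" unfolding affine_lines_def by blast
  show "{v :: 'a^2. a * v $ 1 + b * v $ 2 = 0} \<subseteq> {0 + t *s d | t. True}"
  proof
    fix v assume "v \<in> {v :: 'a^2. a * v $ 1 + b * v $ 2 = 0}"
    then have v: "a * v $ 1 + b * v $ 2 = 0" by simp
    show "v \<in> {0 + t *s d | t. True}"
    proof (cases "a = 0")
      case True
      then have "v = 0 + (- v $ 1 / b) *s d" using assms v
        by (simp add: d_def vec_eq_iff forall_2)
      then show ?thesis by blast
    next
      case False
      have "a * v $ 1 = - (b * v $ 2)" using v by (simp add: eq_neg_iff_add_eq_0)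
      then have "v $ 1 = - (b * v $ 2) / a" using False
        by (metis nonzero_mult_div_cancel_left)
      then have "v = 0 + (v $ 2 / a) *s d" using False
        by (simp add: d_def vec_eq_iff forall_2)
      then show ?thesis by blast
    qed
  qed
qed

lemma kernel_subset_line:
  fixes A :: "'a::field^2^2"
  assumes "A \<noteq> 0"
  shows "\<exists>l\<in>affine_lines. {v. A *v v = 0} \<subseteq> l"
proof -
  obtain i where "A $ i $ 1 \<noteq> 0 \<or> A $ i $ 2 \<noteq> 0"
    using assms by (auto simp: vec_eq_iff forall_2)
  moreover have "{v. A *v v = 0} \<subseteq> {v. A $ i $ 1 * v $ 1 + A $ i $ 2 * v $ 2 = 0}"
    by (auto simp: vec_eq_iff matrix_vector_mult_def sum_2)
  ultimately show ?thesis
    using linear_equation_subset_line[of "A $ i $ 1" "A $ i $ 2"] by blast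
qed

lemma singular_image_subset_line:
  fixes A :: "'a::field^2^2"
  assumes "A \<noteq> 0" "det A = 0"
  shows "\<exists>l\<in>affine_lines. range (\<lambda>v. A *v v) \<subseteq> l"
proof -
  \<comment> \<open>Column \<open>j\<close> is nonzero and, as the determinant vanishes, spans the
    image. The linear form with coefficients \<open>A $ 2 $ j\<close> and \<open>- A $ 1 $ j\<close>
    kills it.\<close>
  obtain j where j: "A $ 2 $ j \<noteq> 0 \<or> - A $ 1 $ j \<noteq> 0"
    using assms(1) by (auto simp: vec_eq_iff forall_2)
  have det: "A $ 1 $ 1 * A $ 2 $ 2 = A $ 1 $ 2 * A $ 2 $ 1" using assms(2) by (simp add: det_2)
  have "A $ 2 $ j * (A $ 1 $ 1 * v $ 1 + A $ 1 $ 2 * v $ 2) +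
      - A $ 1 $ j * (A $ 2 $ 1 * v $ 1 + A $ 2 $ 2 * v $ 2) = 0" for v :: "'a^2"
  proof -
    have "A $ 1 $ 1 * (A $ 2 $ 2 * c) = A $ 1 $ 2 * (A $ 2 $ 1 * c)" for c
      using det by (simp flip: mult.assoc)
    then show ?thesis using exhaust_2[of j] by (auto simp: algebra_simps)
  qed
  then have "range (\<lambda>v. A *v v) \<subseteq> {w. A $ 2 $ j * w $ 1 + - A $ 1 $ j * w $ 2 = 0}"
    by (auto simp: matrix_vector_mult_def sum_2)
  then show ?thesis using linear_equation_subset_line[OF j] by blast
qed

lemma graph_stabilizer_det_nonzero:
  fixes f :: "'a::{field,finite} poly"
  assumes "CARD('a) = q ^ n" "low_weight n q f"
    and diff: "\<And>v w. v \<in> poly_graph f \<Longrightarrow> w \<in> poly_graph f \<Longrightarrow> v - w \<in> poly_graph f"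
    and A: "A \<in> graph_stabilizer f" "A \<noteq> 0"
  shows "det A \<noteq> 0"
proof
  assume "det A = 0"
  define G where "G = poly_graph f"
  have low: "real (card S) < real q powr (real n / 2)"
    if "l \<in> affine_lines" "S \<subseteq> l \<inter> G" for S l
  proof -
    have "card S \<le> card (l \<inter> G)" using that by (intro card_mono) auto
    then show ?thesis using assms(2) that(1) unfolding low_weight_def G_def
      by (meson le_less_trans of_nat_mono)
  qed
  obtain l where l: "l \<in> affine_lines" "{v. A *v v = 0} \<subseteq> l"
    using kernel_subset_line[OF A(2)] by blast
  obtain m where m: "m \<in> affine_lines" "range (\<lambda>v. A *v v) \<subseteq> m"
    using singular_image_subset_line[OF A(2) \<open>det A = 0\<close>] by blast
  have ker: "real (card {v \<in> G. A *v v = 0}) < real q powr (real n / 2)"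
    using l by (intro low[of l]) auto
  have im: "real (card ((\<lambda>v. A *v v) ` G)) < real q powr (real n / 2)"
    using m A(1) by (intro low[of m]) (auto simp: graph_stabilizer_def G_def)
  \<comment> \<open>Since \<open>0 powr x = 0\<close>, the bound \<open>ker\<close> would make a
    cardinality negative if \<open>q = 0\<close>; \<open>powr_realpow\<close> asks for a positive
    base.\<close>
  have "q > 0"
  proof (rule ccontr)
    assume "\<not> q > 0" with ker show False by simp
  qed
  have "real (q ^ n) = real (card G)" using assms(1) card_poly_graph[of f] by (simp add: G_def)
  also have "\<dots> \<le> real (card {v \<in> G. A *v v = 0}) * real (card ((\<lambda>v. A *v v) ` G))"
    using card_le_kernel_times_image[of G A] diff unfolding G_def of_nat_mult[symmetric]
    by (intro of_nat_mono) blast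
  also have "\<dots> < real q powr (real n / 2) * real q powr (real n / 2)"
    using ker im by (intro mult_strict_mono') auto
  also have "\<dots> = real (q ^ n)" using \<open>q > 0\<close> by (simp flip: powr_add add: powr_realpow)
  finally show False by simp
qed

text \<open>On the finite graph the injective map \<open>A\<close> is onto, so its inverse matrix
  sends graph points back to graph points.\<close>

lemma graph_stabilizer_inverse:
  fixes f :: "'a::{field,finite} poly"
  assumes "A \<in> graph_stabilizer f" "det A \<noteq> 0"
  shows "\<exists>B\<in>graph_stabilizer f. A ** B = mat 1"
proof -
  obtain B where B: "A ** B = mat 1" "B ** A = mat 1"
    using assms(2) invertible_det_nz[of A] by (auto simp: invertible_def)
  have "inj_on (\<lambda>v. A *v v) (poly_graph f)"
    by (rule inj_onI) (metis B(2) matrix_vector_mul_assoc matrix_vector_mul_lid)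
  then have "(\<lambda>v. A *v v) ` poly_graph f = poly_graph f"
    using assms(1) by (intro endo_inj_surj) (auto simp: graph_stabilizer_def)
  then have "B *v v \<in> poly_graph f" if "v \<in> poly_graph f" for v
    using that B(2) by (metis imageE matrix_vector_mul_assoc matrix_vector_mul_lid)
  then show ?thesis using B(1) by (auto simp: graph_stabilizer_def)
qed

theorem theorem2p3:
  fixes f :: "'a::{field,finite} poly" and q n :: nat
  assumes "primepow q"
    and "n > 0"
    and "CARD('a) = q ^ n"
    and "f \<in> q_polynomials n q"
    and "low_weight n q f"
  shows "field (matrix_ring_on (graph_stabilizer f))"
proof -
  let ?S = "graph_stabilizer f" and ?R = "matrix_ring_on (graph_stabilizer f)"
  have add: "poly f (x + y) = poly f x + poly f y" for x y
    using q_polynomial_add assms by blast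
  have poly_diff: "poly f (x - y) = poly f x - poly f y" for x y
    using add[of "x - y" y] by (simp add: algebra_simps)
  have diff: "v - w \<in> poly_graph f" if "v \<in> poly_graph f" "w \<in> poly_graph f" for v w
    using that by (simp add: mem_poly_graph_iff poly_diff)
  interpret matrix_division_ring ?S
  proof
    show "mat 1 \<in> ?S" by (auto simp: graph_stabilizer_def)
    show "A - B \<in> ?S" if "A \<in> ?S" "B \<in> ?S" for A B
      using that diff by (simp add: mem_graph_stabilizer_iff matrix_vector_mult_diff_rdistrib)
    show "A ** B \<in> ?S" if "A \<in> ?S" "B \<in> ?S" for A B
      using that by (simp add: mem_graph_stabilizer_iff flip: matrix_vector_mul_assoc)
    show "\<exists>B\<in>?S. A ** B = mat 1" if "A \<in> ?S" "A \<noteq> 0" for A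
      using that graph_stabilizer_det_nonzero[OF assms(3,5) diff] graph_stabilizer_inverse by blast
  qed
  have R: "carrier ?R = ?S" "monoid.mult ?R = (**)" "one ?R = mat 1" "zero ?R = 0" "add ?R = (+)"
    by (simp_all add: matrix_ring_on_def)
  have "abelian_group ?R"
  proof (rule abelian_groupI, unfold R)
    show "\<exists>B\<in>?S. B + A = 0" if "A \<in> ?S" for A
      using that diff_closed[OF zero_closed] by (intro bexI[of _ "0 - A"]) auto
  qed (auto simp: add_closed zero_closed)
  moreover have "comm_monoid ?R"
    by (rule comm_monoidI, unfold R)
      (auto simp: mult_closed one_closed matrix_mul_assoc intro: mult_commute)
  ultimately have "cring ?R"
    by (rule cringI) (simp add: R matrix_add_rdistrib_2)
  then show ?thesis
  proof (rule cring.cring_fieldI2, unfold R)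
    show "(0 :: 'a^2^2) \<noteq> mat 1" by (simp add: mat2_entries)
  qed (use inverse_exists in blast)
qed

end
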